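(* Let $m\ge 2$ and let $L_m=\langle a,t \mid a^m,\ [t^{i}at^{-i},t^{j}at^{-j}],\ i,j\in\mathbb{Z}\rangle$. The language of all geodesics for $L_m$ with respect to the generating set $\{a,t\}$ is not counter.
   Context: $L_m$ is the lamplighter group, i.e. the wreath product $\mathbb{Z}_m\wr\mathbb{Z}$, where $a$ generates $\mathbb{Z}_m$ and $t$ generates $\mathbb{Z}$. For a group $G$ with finite generating set $X$, words are finite strings over the alphabet $X\cup X^{-1}$ (as a subset of $G$); a word is geodesic if its length equals the word length (with respect to $X$) of the element it represents. For a group $H$ and a finite alphabet $A$, a (non-deterministic) $H$-automaton over $A$ is a finite directed graph with a distinguished start vertex, some distinguished accept vertices, and edges labelled by elements of $(A\cup\{\epsilon\})\times H$, where $\epsilon$ is the empty string. For a path $p$, $w(p)$ is the word obtained by concatenating the first components of its edge labels and $g(p)\in H$ is the product of the second components (the empty path gives the empty word and the identity). The automaton accepts a word $w$ if there is a path $p$ from the start vertex to an accept vertex with $w(p)=w$ and $g(p)=1$ in $H$. A language is $k$-counter if it is the set of words accepted by some $\mathbb{Z}^k$-automaton, and counter if it is $k$-counter for some $k\ge 1$. *)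

theory Defs
  imports "HOL-Algebra.Product_Groups" "Graph_Theory.Arc_Walk"
begin

text \<open>
  A word over formal generators is a list of signed letters; \<open>(x, True)\<close> stands for \<open>x\<close>
  and \<open>(x, False)\<close> for its formal inverse.
\<close>

type_synonym 'g gword = "('g \<times> bool) list"

definition gword_inv :: "'g gword \<Rightarrow> 'g gword" where
  "gword_inv u = rev (map (\<lambda>(x, b). (x, \<not> b)) u)"

definition gword_pow :: "'g \<Rightarrow> int \<Rightarrow> 'g gword" where
  "gword_pow x i = replicate (nat \<bar>i\<bar>) (x, 0 \<le> i)"

definition gword_commutator :: "'g gword \<Rightarrow> 'g gword \<Rightarrow> 'g gword" where
  "gword_commutator u v = u @ v @ gword_inv u @ gword_inv v"

inductive pres_equiv :: "'g gword set \<Rightarrow> 'g gword \<Rightarrow> 'g gword \<Rightarrow> bool"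
  for R :: "'g gword set" where
  refl: "pres_equiv R w w"
| sym: "pres_equiv R u v \<Longrightarrow> pres_equiv R v u"
| trans: "pres_equiv R u v \<Longrightarrow> pres_equiv R v w \<Longrightarrow> pres_equiv R u w"
| cancel: "pres_equiv R (u @ [(x, b), (x, \<not> b)] @ v) (u @ v)"
| relator: "r \<in> R \<Longrightarrow> pres_equiv R (u @ r @ v) (u @ v)"

definition pres_class :: "'g gword set \<Rightarrow> 'g gword \<Rightarrow> 'g gword set" where
  "pres_class R u = {w. pres_equiv R u w}"

text \<open>The generators are all elements of the type \<open>'g\<close>.\<close>

definition presented_group :: "'g gword set \<Rightarrow> 'g gword set monoid" where
  "presented_group R =
     \<lparr>carrier = range (pres_class R),
      monoid.mult = (\<lambda>C D. \<Union>u\<in>C. \<Union>v\<in>D. pres_class R (u @ v)),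
      one = pres_class R []\<rparr>"

definition pres_gen :: "'g gword set \<Rightarrow> 'g \<Rightarrow> 'g gword set" where
  "pres_gen R x = pres_class R [(x, True)]"

lemma pres_class_eq_iff: "pres_class R u = pres_class R v \<longleftrightarrow> pres_equiv R u v"
  unfolding pres_class_def set_eq_iff mem_Collect_eq
  by (meson pres_equiv.refl pres_equiv.sym pres_equiv.trans)

lemma pres_equiv_appendL: "pres_equiv R u v \<Longrightarrow> pres_equiv R (p @ u) (p @ v)"
proof (induction rule: pres_equiv.induct)
  case (cancel u x b v)
  show ?case using pres_equiv.cancel[of R "p @ u" x b v] by simp
next
  case (relator r u v)
  then show ?case using pres_equiv.relator[of r R "p @ u" v] by simp
qed (blast intro: pres_equiv.refl pres_equiv.sym pres_equiv.trans)+

lemma pres_equiv_appendR: "pres_equiv R u v \<Longrightarrow> pres_equiv R (u @ p) (v @ p)"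
proof (induction rule: pres_equiv.induct)
  case (cancel u x b v)
  show ?case using pres_equiv.cancel[of R u x b "v @ p"] by simp
next
  case (relator r u v)
  then show ?case using pres_equiv.relator[of r R u "v @ p"] by simp
qed (blast intro: pres_equiv.refl pres_equiv.sym pres_equiv.trans)+

lemma presented_group_mult:
  "pres_class R u \<otimes>\<^bsub>presented_group R\<^esub> pres_class R v = pres_class R (u @ v)"
proof -
  have "pres_class R (u' @ v') = pres_class R (u @ v)"
    if "u' \<in> pres_class R u" "v' \<in> pres_class R v" for u' v'
  proof -
    have "pres_equiv R (u @ v) (u' @ v)"
      using that(1) by (simp add: pres_class_def pres_equiv_appendR)
    moreover have "pres_equiv R (u' @ v) (u' @ v')"
      using that(2) by (simp add: pres_class_def pres_equiv_appendL)
    ultimately show ?thesis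
      by (metis pres_class_eq_iff pres_equiv.trans)
  qed
  moreover have "u \<in> pres_class R u" "v \<in> pres_class R v"
    by (simp_all add: pres_class_def pres_equiv.refl)
  ultimately have "(\<Union>u'\<in>pres_class R u. \<Union>v'\<in>pres_class R v. pres_class R (u' @ v'))
      = pres_class R (u @ v)"
    by blast
  then show ?thesis by (simp add: presented_group_def)
qed

lemma presented_group_carrier: "carrier (presented_group R) = range (pres_class R)"
  and presented_group_one: "\<one>\<^bsub>presented_group R\<^esub> = pres_class R []"
  by (simp_all add: presented_group_def)

lemma pres_equiv_inv_left: "pres_equiv R (gword_inv u @ u) []"
proof (induction u)
  case Nil
  show ?case by (simp add: gword_inv_def pres_equiv.refl)
next
  case (Cons y u)
  obtain x b where y: "y = (x, b)" by fastforce
  have "pres_equiv R (gword_inv (y # u) @ y # u) (gword_inv u @ u)"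
    using pres_equiv.cancel[of R "gword_inv u" x "\<not> b" u] by (simp add: gword_inv_def y)
  then show ?case using Cons.IH pres_equiv.trans by blast
qed

lemma group_presented_group: "group (presented_group R)"
proof (rule groupI)
  fix C assume "C \<in> carrier (presented_group R)"
  then obtain u where C: "C = pres_class R u" by (auto simp: presented_group_carrier)
  have "pres_class R (gword_inv u) \<otimes>\<^bsub>presented_group R\<^esub> C = \<one>\<^bsub>presented_group R\<^esub>"
    by (simp add: C presented_group_mult presented_group_one pres_class_eq_iff
        pres_equiv_inv_left)
  then show "\<exists>D\<in>carrier (presented_group R). D \<otimes>\<^bsub>presented_group R\<^esub> C = \<one>\<^bsub>presented_group R\<^esub>"
    by (auto simp: presented_group_carrier)
qed (auto simp: presented_group_carrier presented_group_mult presented_group_one)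

text \<open>
  The alphabet is a subset of the group: a letter and its inverse coincide if the generator
  is an involution. The element represented by a word \<open>w\<close> is \<open>foldr (\<otimes>) w \<one>\<close>.
\<close>

definition letters :: "('h, 'b) monoid_scheme \<Rightarrow> 'h set \<Rightarrow> 'h set" where
  "letters G X = X \<union> m_inv G ` X"

definition word_length :: "('h, 'b) monoid_scheme \<Rightarrow> 'h set \<Rightarrow> 'h \<Rightarrow> nat" where
  "word_length G X g =
     (LEAST n. \<exists>w\<in>lists (letters G X). foldr (\<otimes>\<^bsub>G\<^esub>) w \<one>\<^bsub>G\<^esub> = g \<and> length w = n)"

definition geodesics :: "('h, 'b) monoid_scheme \<Rightarrow> 'h set \<Rightarrow> 'h list set" where
  "geodesics G X =
     {w \<in> lists (letters G X). length w = word_length G X (foldr (\<otimes>\<^bsub>G\<^esub>) w \<one>\<^bsub>G\<^esub>)}"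

text \<open>The letter \<open>None\<close> represents the empty string.\<close>

record ('v, 'e, 'a, 'h) group_automaton =
  graph :: "('v, 'e) pre_digraph"
  start :: 'v
  accept :: "'v set"
  letter :: "'e \<Rightarrow> 'a option"
  weight :: "'e \<Rightarrow> 'h"

definition is_group_automaton ::
  "('h, 'b) monoid_scheme \<Rightarrow> 'a set \<Rightarrow> ('v, 'e, 'a, 'h) group_automaton \<Rightarrow> bool" where
  "is_group_automaton H A M \<longleftrightarrow>
     group H \<and> finite A \<and> fin_digraph (graph M) \<and>
     start M \<in> verts (graph M) \<and> accept M \<subseteq> verts (graph M) \<and>
     (\<forall>e\<in>arcs (graph M). set_option (letter M e) \<subseteq> A \<and> weight M e \<in> carrier H)"

definition path_word :: "('v, 'e, 'a, 'h) group_automaton \<Rightarrow> 'e list \<Rightarrow> 'a list" where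
  "path_word M p = concat (map (\<lambda>e. case letter M e of None \<Rightarrow> [] | Some x \<Rightarrow> [x]) p)"

definition path_weight ::
  "('h, 'b) monoid_scheme \<Rightarrow> ('v, 'e, 'a, 'h) group_automaton \<Rightarrow> 'e list \<Rightarrow> 'h" where
  "path_weight H M p = foldr (\<otimes>\<^bsub>H\<^esub>) (map (weight M) p) \<one>\<^bsub>H\<^esub>"

definition accepted_language ::
  "('h, 'b) monoid_scheme \<Rightarrow> ('v, 'e, 'a, 'h) group_automaton \<Rightarrow> 'a list set" where
  "accepted_language H M =
     {w. \<exists>p. \<exists>v\<in>accept M. pre_digraph.awalk (graph M) (start M) p v \<and>
        path_word M p = w \<and> path_weight H M p = \<one>\<^bsub>H\<^esub>}"

definition free_abelian_power :: "nat \<Rightarrow> (nat \<Rightarrow> int) monoid" where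
  "free_abelian_power k = product_group {..<k} (\<lambda>_. integer_group)"

text \<open>
  Since the graphs are finite, it is no restriction to take natural numbers as vertices and
  edges.
\<close>

definition k_counter :: "nat \<Rightarrow> 'a list set \<Rightarrow> bool" where
  "k_counter k L \<longleftrightarrow>
     (\<exists>A (M :: (nat, nat, 'a, nat \<Rightarrow> int) group_automaton).
        is_group_automaton (free_abelian_power k) A M \<and>
        L = accepted_language (free_abelian_power k) M)"

definition counter :: "'a list set \<Rightarrow> bool" where
  "counter L \<longleftrightarrow> (\<exists>k\<ge>1. k_counter k L)"

datatype lamp_gen = Lamp | Shift

definition lamp_conj :: "int \<Rightarrow> lamp_gen gword" where
  "lamp_conj i = gword_pow Shift i @ [(Lamp, True)] @ gword_pow Shift (- i)"

definition lamp_relators :: "nat \<Rightarrow> lamp_gen gword set" where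
  "lamp_relators m =
     insert (gword_pow Lamp (int m))
       (range (\<lambda>(i, j). gword_commutator (lamp_conj i) (lamp_conj j)))"

definition lamplighter :: "nat \<Rightarrow> lamp_gen gword set monoid" where
  "lamplighter m = presented_group (lamp_relators m)"

definition lamp_a :: "nat \<Rightarrow> lamp_gen gword set" where
  "lamp_a m = pres_gen (lamp_relators m) Lamp"

definition lamp_t :: "nat \<Rightarrow> lamp_gen gword set" where
  "lamp_t m = pres_gen (lamp_relators m) Shift"

end

theory Submission
  imports Defs
begin

text \<open>
  In a long word of a counter language, cut into blocks, some two consecutive groups of blocks can
  be exchanged, because an accepting path meets one vertex at three block boundaries and the
  weights commute.

  Let \<open>k = \<lfloor>m/2\<rfloor>\<close> and \<open>n = 2\<^sup>N - 1\<close>. The element with all lamps of \<open>{0..n}\<close> in state \<open>k\<close> and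
  the cursor at \<open>0\<close> has a geodesic that runs right, lighting exactly the lamps at the positions
  \<open>2\<^sup>i - 1\<close> with \<open>i < N\<close>, and lights the remaining ones on the way back. The block between
  two consecutive such positions has length \<open>2\<^sup>i\<close>; exchanging blocks on the way right makes it
  light a lamp that is lit again on the way left, and joining the two visits shortens the word.
\<close>

section \<open>Pigeonhole principle with three coinciding values\<close>

lemma ex_three_equal:
  fixes f :: "nat \<Rightarrow> 'b"
  assumes "finite V" "f ` {..N} \<subseteq> V" "2 * card V \<le> N"
  shows "\<exists>i j l. i < j \<and> j < l \<and> l \<le> N \<and> f i = f j \<and> f j = f l"
proof (rule ccontr)
  assume none: "\<nexists>i j l. i < j \<and> j < l \<and> l \<le> N \<and> f i = f j \<and> f j = f l"
  \<comment> \<open>A fibre with three elements would give the forbidden triple, listed in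
    increasing order. With fibres of size at most two, the \<open>N + 1\<close> indices would number
    at most \<open>2 * card V\<close>, hence at most \<open>N\<close>.\<close>
  have fibre: "card {i \<in> {..N}. f i = v} \<le> 2" for v
  proof (rule ccontr)
    assume "\<not> card {i \<in> {..N}. f i = v} \<le> 2"
    then have "Suc (Suc (Suc 0)) \<le> card {i \<in> {..N}. f i = v}" by simp
    then obtain T where T: "T \<subseteq> {i \<in> {..N}. f i = v}" "card T = Suc (Suc (Suc 0))"
      by (rule obtain_subset_with_card_n)
    define xs where "xs = sorted_list_of_set T"
    have "finite T" by (rule card_ge_0_finite) (simp only: T(2) zero_less_Suc)
    then have xs: "set xs = T" "sorted_wrt (<) xs" "length xs = Suc (Suc (Suc 0))"
      unfolding xs_def
      by (simp_all only: set_sorted_list_of_set strict_sorted_list_of_set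
          length_sorted_list_of_set T(2))
    from xs(3) obtain i j l where "xs = [i, j, l]"
      by (auto simp: length_Suc_conv)
    moreover from this xs T(1) have "i < j" "j < l" "l \<le> N" "f i = v" "f j = v" "f l = v"
      by auto
    ultimately show False using none by metis
  qed
  have "Suc N = card {..N}" by simp
  also have "{..N} = (\<Union>v\<in>V. {i \<in> {..N}. f i = v})" using assms(2) by auto
  also have "card \<dots> \<le> (\<Sum>v\<in>V. card {i \<in> {..N}. f i = v})"
    using assms(1) by (rule card_UN_le)
  also have "\<dots> \<le> (\<Sum>v\<in>V. 2)" by (rule sum_mono) (rule fibre)
  also have "\<dots> \<le> N" using assms(3) by simp
  finally show False by simp
qed

section \<open>A swapping lemma for counter languages\<close>

lemma path_word_append: "path_word M (p @ q) = path_word M p @ path_word M q"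
  by (simp add: path_word_def)

lemma path_word_concat: "path_word M (concat ps) = concat (map (path_word M) ps)"
  by (induction ps) (simp_all add: path_word_append, simp add: path_word_def)

text \<open>An edge carries at most one letter, so a cut of the word never falls inside an edge.
  Silent edges at the cut are put into the second piece.\<close>

lemma path_word_split:
  assumes "path_word M p = x @ y"
  shows "\<exists>p1 p2. p = p1 @ p2 \<and> path_word M p1 = x \<and> path_word M p2 = y"
  using assms
proof (induction p arbitrary: x)
  case Nil
  then show ?case by (simp add: path_word_def)
next
  case (Cons e p)
  show ?case
  proof (cases "x = []")
    case True
    then show ?thesis using Cons.prems by (intro exI[of _ "[]"] exI[of _ "e # p"])
      (simp add: path_word_def)
  next
    case False
    have e: "path_word M (e # q) = path_word M [e] @ path_word M q" for q
      by (simp add: path_word_def)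
    obtain x' where x': "x = path_word M [e] @ x'" "path_word M p = x' @ y"
      using Cons.prems False
      by (cases x) (auto simp: path_word_def split: option.splits)
    from Cons.IH[OF x'(2)] obtain p1 p2
      where "p = p1 @ p2" "path_word M p1 = x'" "path_word M p2 = y" by blast
    then show ?thesis
      using x'(1) e[of p1] by (intro exI[of _ "e # p1"] exI[of _ p2]) simp
  qed
qed

lemma path_word_split_concat:
  assumes "path_word M p = concat bs @ z"
  shows "\<exists>ps q. p = concat ps @ q \<and> map (path_word M) ps = bs \<and> path_word M q = z"
  using assms
proof (induction bs arbitrary: p)
  case Nil
  then show ?case by (intro exI[of _ "[]"] exI[of _ p]) simp
next
  case (Cons b bs)
  then have "path_word M p = b @ (concat bs @ z)" by simp
  then obtain p1 p2 where p: "p = p1 @ p2" "path_word M p1 = b" "path_word M p2 = concat bs @ z"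
    using path_word_split by blast
  from Cons.IH[OF p(3)] obtain ps q
    where "p2 = concat ps @ q" "map (path_word M) ps = bs" "path_word M q = z" by blast
  with p show ?case by (intro exI[of _ "p1 # ps"] exI[of _ q]) simp
qed

lemma (in comm_monoid) foldr_mult_closed:
  "set xs \<subseteq> carrier G \<Longrightarrow> foldr (\<otimes>) xs \<one> \<in> carrier G"
  by (induction xs) auto

lemma (in comm_monoid) foldr_mult_append:
  "set xs \<subseteq> carrier G \<Longrightarrow> set ys \<subseteq> carrier G \<Longrightarrow>
    foldr (\<otimes>) (xs @ ys) \<one> = foldr (\<otimes>) xs \<one> \<otimes> foldr (\<otimes>) ys \<one>"
  by (induction xs) (simp_all add: foldr_mult_closed m_assoc)

lemma (in comm_monoid) foldr_mult_swap:
  assumes "set us \<subseteq> carrier G" "set xs \<subseteq> carrier G" "set ys \<subseteq> carrier G" "set vs \<subseteq> carrier G"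
  shows "foldr (\<otimes>) (us @ ys @ xs @ vs) \<one> = foldr (\<otimes>) (us @ xs @ ys @ vs) \<one>"
  using assms by (simp add: foldr_mult_append foldr_mult_closed m_lcomm del: foldr_append)

lemma comm_group_free_abelian_power: "comm_group (free_abelian_power k)"
proof -
  have "group (free_abelian_power k)" by (simp add: free_abelian_power_def)
  then show ?thesis
    by (rule group.group_comm_groupI)
      (simp add: free_abelian_power_def add.commute)
qed

text \<open>Three block boundaries at one vertex enclose two adjacent closed walks. Exchanging these
  leaves a walk with the same ends, and the total weight is unchanged because the weight group is
  abelian. The bound \<open>s\<close> depends only on the number of vertices. The suffix
  \<open>z\<close> stays in place, which later confines the exchange to the way right.\<close>

lemma counter_swap:
  assumes "counter L"
  shows "\<exists>s. \<forall>bs z. s \<le> length bs \<longrightarrow> concat bs @ z \<in> L \<longrightarrow>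
    (\<exists>us xs ys vs. bs = us @ xs @ ys @ vs \<and> xs \<noteq> [] \<and> ys \<noteq> [] \<and>
      concat (us @ ys @ xs @ vs) @ z \<in> L)"
proof -
  from assms obtain k A and M :: "(nat, nat, 'a, nat \<Rightarrow> int) group_automaton"
    where M: "is_group_automaton (free_abelian_power k) A M"
      and L: "L = accepted_language (free_abelian_power k) M"
    by (auto simp: counter_def k_counter_def)
  define H where "H = free_abelian_power k"
  interpret H: comm_group H unfolding H_def by (rule comm_group_free_abelian_power)
  interpret G: fin_digraph "graph M" using M by (simp add: is_group_automaton_def)
  have wt: "weight M e \<in> carrier H" if "e \<in> arcs (graph M)" for e
    using M that by (auto simp: is_group_automaton_def H_def)
  show ?thesis
  proof (intro exI[of _ "2 * card (verts (graph M))"] allI impI)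
    fix bs z assume len: "2 * card (verts (graph M)) \<le> length bs" and "concat bs @ z \<in> L"
    then obtain p v where p: "v \<in> accept M" "G.awalk (start M) p v"
        "path_word M p = concat bs @ z" "path_weight H M p = \<one>\<^bsub>H\<^esub>"
      by (auto simp: L accepted_language_def H_def)
    from path_word_split_concat[OF p(3)] obtain ps q
      where pq: "p = concat ps @ q" "map (path_word M) ps = bs" "path_word M q = z" by blast
    define f where "f r = G.awlast (start M) (concat (take r ps))" for r
    have split: "concat ps = concat (take r ps) @ concat (drop r ps)" for r
      by (metis append_take_drop_id concat_append)
    have "f r \<in> verts (graph M)" for r
    proof -
      have "G.awalk (start M) (concat (take r ps) @ concat (drop r ps) @ q) v"
        using p(2) unfolding pq(1) split[of r] by simp
      then show ?thesis unfolding f_def by (auto simp: G.awlast_in_verts)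
    qed
    then obtain i j l where ijl: "i < j" "j < l" "l \<le> length bs" "f i = f j" "f j = f l"
      using ex_three_equal[OF G.finite_verts _ len, of f] by blast
    define us where "us = take i ps"
    define xs where "xs = take (j - i) (drop i ps)"
    define ys where "ys = take (l - j) (drop j ps)"
    define vs where "vs = drop l ps"
    have lps: "length ps = length bs" using pq(2) by auto
    have tj: "take j ps = us @ xs"
      using ijl take_add[of i "j - i" ps] by (simp add: us_def xs_def)
    then have tl: "take l ps = us @ xs @ ys"
      using ijl take_add[of j "l - j" ps] by (simp add: ys_def)
    have ps: "ps = us @ xs @ ys @ vs"
      using tl unfolding vs_def by (metis append.assoc append_take_drop_id)
    have ne: "xs \<noteq> []" "ys \<noteq> []" using ijl lps by (auto simp: xs_def ys_def)
    have walk: "G.awalk (start M) (concat us @ concat xs @ concat ys @ concat vs @ q) v"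
      using p(2) by (simp add: pq(1) ps)
    have fi: "f i = G.awlast (start M) (concat us)" by (simp add: f_def us_def)
    have fj: "f j = G.awlast (f i) (concat xs)"
      unfolding fi unfolding f_def tj by (simp add: G.awlast_append)
    have fl: "f l = G.awlast (f j) (concat ys)"
      unfolding f_def tj tl by (simp add: G.awlast_append)
    \<comment> \<open>Both middle walks are loops at \<open>f i\<close>, which is what makes the
      exchanged pieces fit together.\<close>
    have ends: "G.awlast (start M) (concat us) = f i"
      "G.awlast (f i) (concat xs) = f i" "G.awlast (f i) (concat ys) = f i"
      using fi fj fl ijl(4,5) by metis+
    let ?p = "concat us @ concat ys @ concat xs @ concat vs @ q"
    have "G.awalk (start M) ?p v"
      using walk by (simp add: ends G.awlast_append)
    moreover have "path_word M ?p = concat (map (path_word M) (us @ ys @ xs @ vs)) @ z"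
      by (simp add: path_word_append path_word_concat pq(3))
    moreover have "path_weight H M ?p = \<one>\<^bsub>H\<^esub>"
    proof -
      have "set (concat us @ concat xs @ concat ys @ concat vs @ q) \<subseteq> arcs (graph M)"
        using walk unfolding G.awalk_def by blast
      then have "path_weight H M ?p =
          path_weight H M (concat us @ concat xs @ concat ys @ concat vs @ q)"
        unfolding path_weight_def map_append
        by (intro H.foldr_mult_swap) (use wt in auto)
      then show ?thesis using p(4) by (simp add: pq(1) ps)
    qed
    ultimately have "concat (map (path_word M) (us @ ys @ xs @ vs)) @ z \<in> L"
      using p(1) unfolding L accepted_language_def H_def[symmetric] by blast
    then show "\<exists>us xs ys vs. bs = us @ xs @ ys @ vs \<and> xs \<noteq> [] \<and> ys \<noteq> [] \<and>
        concat (us @ ys @ xs @ vs) @ z \<in> L"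
      using ne pq(2) unfolding ps
      by (intro exI[of _ "map (path_word M) us"] exI[of _ "map (path_word M) xs"]
          exI[of _ "map (path_word M) ys"] exI[of _ "map (path_word M) vs"]) auto
  qed
qed

section \<open>Geodesics in a presented group\<close>

lemma foldr_pres_class:
  "foldr (\<otimes>\<^bsub>presented_group R\<^esub>) (map (\<lambda>y. pres_class R [y]) v) \<one>\<^bsub>presented_group R\<^esub>
    = pres_class R v"
  by (induction v) (simp_all add: presented_group_one presented_group_mult)

lemma inv_pres_gen: "inv\<^bsub>presented_group R\<^esub> (pres_gen R x) = pres_class R [(x, False)]"
proof (rule group.inv_equality[OF group_presented_group])
  show "pres_class R [(x, False)] \<otimes>\<^bsub>presented_group R\<^esub> pres_gen R x = \<one>\<^bsub>presented_group R\<^esub>"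
    using pres_equiv.cancel[of R "[]" x False "[]"]
    by (simp add: pres_gen_def presented_group_mult presented_group_one pres_class_eq_iff)
qed (auto simp: presented_group_carrier pres_gen_def)

lemma letters_presented_group:
  "letters (presented_group R) (range (pres_gen R)) = range (\<lambda>y. pres_class R [y])"
proof -
  have "range (\<lambda>y. pres_class R [y]) =
      range (\<lambda>x. pres_class R [(x, True)]) \<union> range (\<lambda>x. pres_class R [(x, False)])"
    by (auto simp: image_iff) (metis (full_types))
  then show ?thesis
    by (simp add: letters_def image_image inv_pres_gen) (simp add: pres_gen_def)
qed

text \<open>Different formal letters can be the same group letter, as \<open>a\<close> and its
  inverse are for \<open>m = 2\<close>. Lengths survive the passage to the group, and every word
  over the group letters comes from a formal word, so geodesics can be tested on formal words up to
  \<open>pres_equiv\<close>.\<close>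

lemma geodesics_presented_group_iff:
  "map (\<lambda>y. pres_class R [y]) v \<in> geodesics (presented_group R) (range (pres_gen R)) \<longleftrightarrow>
    (\<forall>u. pres_equiv R u v \<longrightarrow> length v \<le> length u)"
proof -
  let ?c = "map (\<lambda>y. pres_class R [y])"
  let ?P = "\<lambda>n. \<exists>u. pres_equiv R u v \<and> length u = n"
  have lists: "lists (range (\<lambda>y. pres_class R [y])) = range ?c"
    using lists_image[of "\<lambda>y. pres_class R [y]" UNIV] by simp
  have wl: "word_length (presented_group R) (range (pres_gen R)) (pres_class R v) = Least ?P"
    unfolding word_length_def letters_presented_group lists
    by (simp add: foldr_pres_class pres_class_eq_iff)
  have "?c v \<in> geodesics (presented_group R) (range (pres_gen R)) \<longleftrightarrow> length v = Least ?P"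
    by (simp add: geodesics_def letters_presented_group lists foldr_pres_class wl)
  also have "\<dots> \<longleftrightarrow> (\<forall>u. pres_equiv R u v \<longrightarrow> length v \<le> length u)"
  proof
    assume "length v = Least ?P"
    then show "\<forall>u. pres_equiv R u v \<longrightarrow> length v \<le> length u"
      using Least_le[of ?P] by auto
  next
    assume "\<forall>u. pres_equiv R u v \<longrightarrow> length v \<le> length u"
    then show "length v = Least ?P"
      by (intro Least_equality[symmetric]) (auto intro: pres_equiv.refl)
  qed
  finally show ?thesis .
qed

section \<open>The lamps and the position of the cursor\<close>

definition sgn_of :: "bool \<Rightarrow> int" where
  "sgn_of b = (if b then 1 else - 1)"

fun cursor :: "lamp_gen gword \<Rightarrow> int" where
  "cursor [] = 0"
| "cursor ((Lamp, b) # u) = cursor u"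
| "cursor ((Shift, b) # u) = sgn_of b + cursor u"

text \<open>The counts are integers and not residues, so that absolute values can bound the number
  of lamp letters; congruence modulo \<open>m\<close> enters in \<open>pres_equiv_lamp\<close>.
  Positions are relative to the cursor, hence the translated argument after a \<open>Shift\<close>
  letter.\<close>

fun lamp :: "lamp_gen gword \<Rightarrow> int \<Rightarrow> int" where
  "lamp [] q = 0"
| "lamp ((Lamp, b) # u) q = (if q = 0 then sgn_of b else 0) + lamp u q"
| "lamp ((Shift, b) # u) q = lamp u (q - sgn_of b)"

fun lamp_letters :: "lamp_gen gword \<Rightarrow> nat" where
  "lamp_letters [] = 0"
| "lamp_letters ((Lamp, b) # u) = Suc (lamp_letters u)"
| "lamp_letters ((Shift, b) # u) = lamp_letters u"

fun shift_letters :: "lamp_gen gword \<Rightarrow> nat" where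
  "shift_letters [] = 0"
| "shift_letters ((Lamp, b) # u) = shift_letters u"
| "shift_letters ((Shift, b) # u) = Suc (shift_letters u)"

lemma length_letters: "length u = lamp_letters u + shift_letters u"
  by (induction u rule: lamp_letters.induct) simp_all

lemma cursor_append: "cursor (u @ v) = cursor u + cursor v"
  by (induction u rule: cursor.induct) simp_all

lemma lamp_append: "lamp (u @ v) q = lamp u q + lamp v (q - cursor u)"
  by (induction u q rule: lamp.induct) (simp_all add: algebra_simps)

lemma cursor_inv: "cursor (gword_inv u) = - cursor u"
  by (induction u rule: cursor.induct) (simp_all add: gword_inv_def cursor_append sgn_of_def)

lemma lamp_inv: "lamp (gword_inv u) q = - lamp u (q + cursor u)"
proof (induction u arbitrary: q rule: cursor.induct)
  case (2 b u)
  have "lamp (gword_inv ((Lamp, b) # u)) q = lamp (gword_inv u @ [(Lamp, \<not> b)]) q"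
    by (simp add: gword_inv_def)
  then show ?case by (simp add: lamp_append cursor_inv 2 sgn_of_def)
next
  case (3 b u)
  have "lamp (gword_inv ((Shift, b) # u)) q = lamp (gword_inv u @ [(Shift, \<not> b)]) q"
    by (simp add: gword_inv_def)
  then show ?case by (simp add: lamp_append 3 add.commute)
qed (simp add: gword_inv_def)

lemma cursor_replicate_Lamp [simp]: "cursor (replicate n (Lamp, b)) = 0"
  by (induction n) simp_all

lemma cursor_replicate_Shift [simp]: "cursor (replicate n (Shift, b)) = int n * sgn_of b"
  by (induction n) (simp_all add: algebra_simps)

lemma lamp_replicate_Lamp [simp]:
  "lamp (replicate n (Lamp, b)) q = (if q = 0 then int n * sgn_of b else 0)"
  by (induction n) (simp_all add: algebra_simps)

lemma lamp_replicate_Shift [simp]: "lamp (replicate n (Shift, b)) q = 0"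
  by (induction n arbitrary: q) simp_all

lemma cursor_lamp_conj: "cursor (lamp_conj i) = 0"
  by (auto simp: lamp_conj_def gword_pow_def cursor_append sgn_of_def)

section \<open>Invariants of group elements and lower bounds on letter counts\<close>

lemma pres_equiv_lamp:
  assumes "pres_equiv (lamp_relators m) u v"
  shows "cursor u = cursor v \<and> (\<forall>q. int m dvd lamp u q - lamp v q)"
  using assms
proof (induction rule: pres_equiv.induct)
  case (sym u v)
  then show ?case by (metis dvd_diff_commute)
next
  case (trans u v w)
  then have "int m dvd (lamp u q - lamp v q) + (lamp v q - lamp w q)" for q
    using dvd_add by blast
  with trans show ?case by simp
next
  case (cancel u x b v)
  then show ?case
    by (cases x) (simp_all add: cursor_append lamp_append sgn_of_def)
next
  case (relator r u v)
  \<comment> \<open>The power relator adds \<open>m\<close> to the count at \<open>0\<close>. In a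
    commutator each conjugate returns the cursor to its start, so the four contributions
    cancel.\<close>
  have "cursor r = 0 \<and> int m dvd lamp r q" for q
  proof (cases "r = gword_pow Lamp (int m)")
    case True
    then show ?thesis by (simp add: gword_pow_def sgn_of_def)
  next
    case False
    with relator obtain i j where "r = gword_commutator (lamp_conj i) (lamp_conj j)"
      by (auto simp: lamp_relators_def)
    then show ?thesis
      by (simp add: gword_commutator_def cursor_append lamp_append cursor_inv lamp_inv
          cursor_lamp_conj)
  qed
  then show ?case by (simp add: cursor_append lamp_append)
qed simp

text \<open>A lamp with nonzero count has been visited, so the cursor travels from \<open>0\<close>
  to \<open>q\<close> and from there to its final position.\<close>

lemma shift_letters_ge: "lamp u q \<noteq> 0 \<Longrightarrow> \<bar>q\<bar> + \<bar>q - cursor u\<bar> \<le> int (shift_letters u)"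
proof (induction u arbitrary: q rule: cursor.induct)
  case (2 b u)
  \<comment> \<open>If only the first letter touches lamp \<open>q\<close>, then
    \<open>q = 0\<close>, and just the trip from \<open>0\<close> to the final position has to be
    bounded.\<close>
  have "\<bar>cursor u\<bar> \<le> int (shift_letters u)"
    by (induction u rule: cursor.induct) (auto simp: sgn_of_def)
  with 2 show ?case by (cases "lamp u q = 0") (auto split: if_splits)
next
  case (3 b u)
  from 3(1)[of "q - sgn_of b"] 3(2) show ?case by (auto simp: sgn_of_def split: if_splits)
qed simp

text \<open>Each lamp letter changes a single count by one. The set \<open>F\<close> is arbitrary
  because a shift letter translates it in the induction.\<close>

lemma lamp_letters_ge: "finite F \<Longrightarrow> (\<Sum>q\<in>F. \<bar>lamp u q\<bar>) \<le> int (lamp_letters u)"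
proof (induction u arbitrary: F rule: cursor.induct)
  case (2 b u)
  have "(\<Sum>q\<in>F. \<bar>lamp ((Lamp, b) # u) q\<bar>) \<le> (\<Sum>q\<in>F. (if q = 0 then 1 else 0) + \<bar>lamp u q\<bar>)"
    by (rule sum_mono) (auto simp: sgn_of_def)
  also have "\<dots> \<le> 1 + (\<Sum>q\<in>F. \<bar>lamp u q\<bar>)"
    using 2(2) by (simp add: sum.distrib)
  also have "\<dots> \<le> 1 + int (lamp_letters u)" using 2 by simp
  finally show ?case by simp
next
  case (3 b u)
  have "(\<Sum>q\<in>F. \<bar>lamp u (q - sgn_of b)\<bar>) = (\<Sum>q\<in>(\<lambda>q. q - sgn_of b) ` F. \<bar>lamp u q\<bar>)"
    by (subst sum.reindex) (auto simp: inj_on_def)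
  also have "\<dots> \<le> int (lamp_letters u)" using 3 by simp
  finally show ?case by simp
qed simp

text \<open>The next smaller member of the residue class is \<open>m div 2 - m\<close>, which is at
  most \<open>- (m div 2)\<close>; so \<open>m div 2\<close> has least absolute value in its
  class.\<close>

lemma abs_ge_half_modulus:
  fixes x :: int
  assumes "int m dvd x - int (m div 2)"
  shows "int (m div 2) \<le> \<bar>x\<bar>"
proof -
  from assms obtain c where c: "x = int (m div 2) + int m * c"
    by (metis add_diff_eq dvdE diff_add_cancel add.commute)
  show ?thesis
  proof (cases "c \<ge> 0")
    case True
    then show ?thesis using c by simp
  next
    case False
    then have "int m * c \<le> int m * - 1" by (intro mult_left_mono) auto
    then show ?thesis using c by linarith
  qed
qed

section \<open>Commutation in the base group\<close>

lemma pres_equiv_inv_right: "pres_equiv R (u @ gword_inv u) []"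
  using pres_equiv_inv_left[of R "gword_inv u"]
  by (simp add: gword_inv_def rev_map o_def case_prod_beta)


definition words_commute :: "'g gword set \<Rightarrow> 'g gword \<Rightarrow> 'g gword \<Rightarrow> bool" where
  "words_commute R u v \<longleftrightarrow> pres_equiv R (u @ v) (v @ u)"

lemma words_commute_Nil: "words_commute R [] v"
  by (simp add: words_commute_def pres_equiv.refl)

lemma words_commute_sym: "words_commute R u v \<Longrightarrow> words_commute R v u"
  by (simp add: words_commute_def pres_equiv.sym)

lemma words_commute_cong:
  assumes "pres_equiv R u u'" "words_commute R u v"
  shows "words_commute R u' v"
  using assms unfolding words_commute_def
  by (meson pres_equiv_appendL pres_equiv_appendR pres_equiv.sym pres_equiv.trans)

lemma words_commute_append:
  assumes "words_commute R u w" "words_commute R v w"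
  shows "words_commute R (u @ v) w"
proof -
  have "pres_equiv R (u @ v @ w) (u @ w @ v)"
    using assms(2) by (simp add: words_commute_def pres_equiv_appendL)
  moreover have "pres_equiv R ((u @ w) @ v) ((w @ u) @ v)"
    using assms(1) by (simp only: words_commute_def pres_equiv_appendR)
  ultimately show ?thesis
    unfolding words_commute_def append_assoc by (rule pres_equiv.trans)
qed

text \<open>With \<open>U\<close> for the inverse of \<open>u\<close>, the chain is
  \<open>U w = U w u U = U u w U = w U\<close>.\<close>

lemma words_commute_inv:
  assumes "words_commute R u w"
  shows "words_commute R (gword_inv u) w"
proof -
  let ?u = "gword_inv u"
  have "pres_equiv R (?u @ w) (?u @ w @ u @ ?u)"
    using pres_equiv_appendL[OF pres_equiv_inv_right, of R "?u @ w" u]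
    by (simp add: pres_equiv.sym)
  moreover have "pres_equiv R (?u @ (w @ u) @ ?u) (?u @ (u @ w) @ ?u)"
    using assms unfolding words_commute_def
    by (intro pres_equiv_appendL pres_equiv_appendR) (rule pres_equiv.sym)
  moreover have "pres_equiv R ((?u @ u) @ w @ ?u) ([] @ w @ ?u)"
    by (intro pres_equiv_appendR pres_equiv_inv_left)
  ultimately show ?thesis
    unfolding words_commute_def append_assoc append_Nil by (blast intro: pres_equiv.trans)
qed

text \<open>Put the commutator in front of \<open>v @ u\<close>, then cancel first \<open>v\<close>
  and next \<open>u\<close> against their inverses; what remains is \<open>u @ v\<close>.\<close>

lemma words_commute_of_commutator:
  assumes "gword_commutator u v \<in> R"
  shows "words_commute R u v"
proof -
  have "pres_equiv R (u @ v @ gword_inv u @ gword_inv v @ v @ u) (v @ u)"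
    using pres_equiv.relator[OF assms, of "[]" "v @ u"] by (simp add: gword_commutator_def)
  moreover have "pres_equiv R ((u @ v @ gword_inv u) @ (gword_inv v @ v) @ u)
      ((u @ v @ gword_inv u) @ [] @ u)"
    by (intro pres_equiv_appendL pres_equiv_appendR pres_equiv_inv_left)
  moreover have "pres_equiv R ((u @ v) @ gword_inv u @ u) ((u @ v) @ [])"
    by (intro pres_equiv_appendL pres_equiv_inv_left)
  ultimately show ?thesis
    unfolding words_commute_def append_assoc append_Nil append_Nil2
    by (meson pres_equiv.sym pres_equiv.trans)
qed

lemma gword_pow_minus: "gword_pow x (- i) = gword_inv (gword_pow x i)"
  by (cases "i = 0") (auto simp: gword_pow_def gword_inv_def)

text \<open>Powers are spelled with letters of one sign, so a further letter either lengthens the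
  word or cancels its last letter. Exponent \<open>0\<close> can be lengthened with either
  sign.\<close>

lemma gword_pow_step: "pres_equiv R (gword_pow x i @ [(x, b)]) (gword_pow x (i + sgn_of b))"
proof (cases "i = 0 \<or> (0 \<le> i \<longleftrightarrow> b)")
  case True
  then have "gword_pow x i @ [(x, b)] = gword_pow x (i + sgn_of b)"
  proof (cases b)
    case True
    with \<open>i = 0 \<or> (0 \<le> i \<longleftrightarrow> b)\<close> have "0 \<le> i" by auto
    then have "nat \<bar>i + 1\<bar> = Suc (nat \<bar>i\<bar>)" by simp
    with True \<open>0 \<le> i\<close> show ?thesis
      by (simp add: gword_pow_def sgn_of_def replicate_append_same)
  next
    case False
    with \<open>i = 0 \<or> (0 \<le> i \<longleftrightarrow> b)\<close> have i: "i \<le> 0" by auto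
    then have "nat \<bar>i - 1\<bar> = Suc (nat \<bar>i\<bar>)" by simp
    with False i show ?thesis
      by (cases "i = 0") (auto simp: gword_pow_def sgn_of_def replicate_append_same)
  qed
  then show ?thesis by (simp add: pres_equiv.refl)
next
  case False
  then have i: "i \<noteq> 0" "0 \<le> i \<longleftrightarrow> \<not> b" by auto
  then have "nat \<bar>i\<bar> = Suc (nat \<bar>i + sgn_of b\<bar>)" by (auto simp: sgn_of_def)
  then have "gword_pow x i = replicate (nat \<bar>i + sgn_of b\<bar>) (x, \<not> b) @ [(x, \<not> b)]"
    using i by (simp add: gword_pow_def replicate_append_same)
  moreover have "replicate (nat \<bar>i + sgn_of b\<bar>) (x, \<not> b) = gword_pow x (i + sgn_of b)"
    using i by (cases "i + sgn_of b = 0") (auto simp: gword_pow_def sgn_of_def split: if_splits)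
  ultimately show ?thesis
    using pres_equiv.cancel[of R "gword_pow x (i + sgn_of b)" x "\<not> b" "[]"] by simp
qed

text \<open>
  With the cursor moved back, every word is a product of conjugates of the lamp generator and of
  their inverses.
\<close>

lemma words_commute_lamp_conj:
  "words_commute (lamp_relators m) (gword_pow Shift i @ v @ gword_pow Shift (- i - cursor v))
    (lamp_conj j)"
proof (induction v arbitrary: i rule: cursor.induct)
  case 1
  have "pres_equiv (lamp_relators m) [] (gword_pow Shift i @ gword_pow Shift (- i))"
    unfolding gword_pow_minus by (rule pres_equiv.sym[OF pres_equiv_inv_right])
  then show ?case using words_commute_cong words_commute_Nil by simp blast
next
  \<comment> \<open>A lamp letter met at position \<open>i\<close> splits off a conjugate of the
    lamp generator or of its inverse, once the trivial word \<open>?S (- i) @ ?S i\<close> is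
    inserted behind it.\<close>
  case (2 b v)
  let ?R = "lamp_relators m" and ?S = "gword_pow Shift"
  have "words_commute ?R (lamp_conj i) (lamp_conj j)"
    by (rule words_commute_of_commutator) (auto simp: lamp_relators_def)
  moreover have "gword_inv (lamp_conj i) = ?S i @ [(Lamp, False)] @ ?S (- i)"
    unfolding lamp_conj_def gword_pow_minus
    by (simp add: gword_inv_def rev_map o_def case_prod_beta)
  ultimately have "words_commute ?R (?S i @ [(Lamp, b)] @ ?S (- i)) (lamp_conj j)"
    by (cases b) (metis lamp_conj_def, metis words_commute_inv)
  from words_commute_append[OF this 2[of i]]
  have comm: "words_commute ?R ((?S i @ [(Lamp, b)] @ ?S (- i)) @ ?S i @ v @ ?S (- i - cursor v))
      (lamp_conj j)" .
  have "pres_equiv ?R ((?S i @ [(Lamp, b)]) @ (?S (- i) @ ?S i) @ v @ ?S (- i - cursor v))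
      ((?S i @ [(Lamp, b)]) @ [] @ v @ ?S (- i - cursor v))"
    unfolding gword_pow_minus
    by (intro pres_equiv_appendL pres_equiv_appendR pres_equiv_inv_left)
  with comm show ?case using words_commute_cong by simp blast
next
  \<comment> \<open>A shift letter is absorbed into the prefix, so the induction hypothesis is taken
    at \<open>i + sgn_of b\<close>.\<close>
  case (3 b v)
  let ?R = "lamp_relators m" and ?S = "gword_pow Shift"
  have "pres_equiv ?R (?S (i + sgn_of b) @ v @ ?S (- (i + sgn_of b) - cursor v))
     ((?S i @ [(Shift, b)]) @ v @ ?S (- (i + sgn_of b) - cursor v))"
    by (intro pres_equiv_appendR pres_equiv.sym[OF gword_pow_step])
  from words_commute_cong[OF this 3] show ?case by (simp add: algebra_simps)
qed

text \<open>The lamp generator is \<open>lamp_conj 0\<close>; for \<open>i = 0\<close> and cursor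
  \<open>0\<close> the added powers of \<open>Shift\<close> are empty.\<close>

lemma words_commute_lamps:
  assumes "cursor v = 0"
  shows "words_commute (lamp_relators m) v (replicate k (Lamp, True))"
proof -
  have "words_commute (lamp_relators m) v [(Lamp, True)]"
    using words_commute_lamp_conj[of m 0 v 0] assms by (simp add: gword_pow_def lamp_conj_def)
  then have "words_commute (lamp_relators m) (replicate k (Lamp, True)) v"
  proof (induction k)
    case (Suc k)
    then show ?case
      using words_commute_append[of _ "[(Lamp, True)]" v "replicate k (Lamp, True)"]
      by (simp add: words_commute_sym)
  qed (simp add: words_commute_Nil)
  then show ?thesis by (rule words_commute_sym)
qed

text \<open>
  The two visits add up to \<open>a\<^sup>2\<^sup>k\<close> with \<open>k = \<lfloor>m/2\<rfloor>\<close>, which is \<open>1\<close> or the inverse of \<open>a\<close>.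
\<close>

lemma lit_twice_shortens:
  fixes m :: nat
  assumes "m \<ge> 2" "cursor v = 0"
  defines "a \<equiv> replicate (m div 2) (Lamp, True)"
  shows "\<exists>u'. pres_equiv (lamp_relators m) u' (u @ a @ v @ a @ w) \<and>
    length u' < length (u @ a @ v @ a @ w)"
proof -
  let ?R = "lamp_relators m"
  \<comment> \<open>This is the parity of \<open>m\<close>. The \<open>2 * (m div 2)\<close> lamp
    letters equal \<open>d\<close> inverse ones, and \<open>d \<le> 1 < 2 * (m div 2)\<close> makes
    the replacement shorter.\<close>
  define d where "d = m - 2 * (m div 2)"
  let ?c = "replicate d (Lamp, False)"
  have inv: "?c = gword_inv (replicate d (Lamp, True))"
    by (simp add: gword_inv_def)
  have m: "m = m div 2 + (m div 2 + d)" by (simp add: d_def)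
  have "gword_pow Lamp (int m) = a @ a @ replicate d (Lamp, True)"
    unfolding a_def replicate_add[symmetric] m[symmetric] by (simp add: gword_pow_def)
  moreover have "gword_pow Lamp (int m) \<in> ?R" by (simp add: lamp_relators_def)
  ultimately have "pres_equiv ?R (a @ a @ replicate d (Lamp, True) @ ?c) ?c"
    using pres_equiv.relator[of _ ?R "[]" ?c] by fastforce
  moreover have "pres_equiv ?R ((a @ a) @ replicate d (Lamp, True) @ ?c) ((a @ a) @ [])"
    unfolding inv by (intro pres_equiv_appendL pres_equiv_inv_right)
  ultimately have aa: "pres_equiv ?R ?c (a @ a)"
    by simp (blast intro: pres_equiv.sym pres_equiv.trans)
  have "pres_equiv ?R (v @ a) (a @ v)"
    using words_commute_lamps[OF assms(2)] by (simp add: a_def words_commute_def)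
  then have "pres_equiv ?R (u @ a @ (v @ a) @ w) (u @ a @ (a @ v) @ w)"
    by (intro pres_equiv_appendL pres_equiv_appendR)
  moreover have "pres_equiv ?R (u @ ?c @ v @ w) (u @ (a @ a) @ v @ w)"
    by (intro pres_equiv_appendL pres_equiv_appendR aa)
  ultimately have "pres_equiv ?R (u @ ?c @ v @ w) (u @ a @ v @ a @ w)"
    by simp (blast intro: pres_equiv.sym pres_equiv.trans)
  moreover have "0 < m div 2" using assms(1) by simp
  then have "d < 2 * (m div 2)" using m unfolding d_def by linarith
  then have "length (u @ ?c @ v @ w) < length (u @ a @ v @ a @ w)"
    by (simp add: a_def)
  ultimately show ?thesis by blast
qed

section \<open>A geodesic that goes right and comes back\<close>

text \<open>In the natural order, the blocks before block \<open>i\<close> move the cursor to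
  \<open>2 ^ i - 1\<close>. Lengths are powers of two because a sum of two different ones is not a
  power of two, which exposes an exchange of blocks.\<close>

definition right_block :: "nat \<Rightarrow> nat \<Rightarrow> lamp_gen gword" where
  "right_block k i = replicate k (Lamp, True) @ replicate (2 ^ i) (Shift, True)"

definition right_word :: "nat \<Rightarrow> nat list \<Rightarrow> lamp_gen gword" where
  "right_word k is = concat (map (right_block k) is)"

text \<open>Here \<open>q\<close> is meant to be the position of the cursor before the step left;
  the set \<open>S\<close> holds the lamps that the way right has lit.\<close>

definition left_block :: "nat \<Rightarrow> nat set \<Rightarrow> nat \<Rightarrow> lamp_gen gword" where
  "left_block k S q = (if q \<in> S then [] else replicate k (Lamp, True)) @ [(Shift, False)]"

definition left_word :: "nat \<Rightarrow> nat set \<Rightarrow> nat list \<Rightarrow> lamp_gen gword" where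
  "left_word k S qs = concat (map (left_block k S) qs)"

definition lit_right :: "nat \<Rightarrow> nat set" where
  "lit_right N = (\<lambda>i. 2 ^ i - 1) ` {..<N}"

lemma right_word_simps [simp]:
  "right_word k [] = []"
  "right_word k (i # is) = right_block k i @ right_word k is"
  "right_word k (is @ js) = right_word k is @ right_word k js"
  by (simp_all add: right_word_def)

lemma left_word_simps [simp]:
  "left_word k S [] = []"
  "left_word k S (q # qs) = left_block k S q @ left_word k S qs"
  "left_word k S (qs @ rs) = left_word k S qs @ left_word k S rs"
  by (simp_all add: left_word_def)

lemma cursor_right_block: "cursor (right_block k i) = 2 ^ i"
  by (simp add: right_block_def cursor_append sgn_of_def)

lemma cursor_right_word: "cursor (right_word k is) = int (\<Sum>i\<leftarrow>is. 2 ^ i)"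
  by (induction "is") (simp_all add: cursor_append cursor_right_block)

lemma sum_list_powers: "(\<Sum>i\<leftarrow>[0..<N]. 2 ^ i) = 2 ^ N - (1::nat)"
  by (induction N) simp_all

lemma cursor_left_word: "cursor (left_word k S qs) = - int (length qs)"
  by (induction qs) (simp_all add: left_block_def cursor_append sgn_of_def)

lemma lit_right_Suc: "lit_right (Suc N) = insert (2 ^ N - 1) (lit_right N)"
  by (simp add: lit_right_def lessThan_Suc)

lemma lit_right_less: "q \<in> lit_right N \<Longrightarrow> q < 2 ^ N - 1"
  by (auto simp: lit_right_def intro!: diff_less_mono)

lemma card_lit_right: "card (lit_right N) = N"
proof (induction N)
  case (Suc N)
  have "2 ^ N - 1 \<notin> lit_right N" using lit_right_less by blast
  with Suc show ?case by (simp add: lit_right_Suc) (simp add: lit_right_def)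
qed (simp add: lit_right_def)

lemma lamp_right_word:
  "lamp (right_word k [0..<N]) (int q) = (if q \<in> lit_right N then int k else 0)"
proof (induction N)
  case (Suc N)
  have "lamp (right_word k [0..<Suc N]) (int q) =
      lamp (right_word k [0..<N]) (int q) + lamp (right_block k N) (int q - int (2 ^ N - 1))"
    using cursor_right_word[of k "[0..<N]"] by (simp only: sum_list_powers) (simp add: lamp_append)
  also have "\<dots> = (if q \<in> lit_right N then int k else 0) + (if q = 2 ^ N - 1 then int k else 0)"
    unfolding Suc by (simp only: right_block_def lamp_append) (simp add: sgn_of_def del: of_nat_diff)
  finally have "lamp (right_word k [0..<Suc N]) (int q) =
      (if q \<in> lit_right N then int k else 0) + (if q = 2 ^ N - 1 then int k else 0)" .
  moreover have "2 ^ N - 1 \<notin> lit_right N" using lit_right_less by blast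
  ultimately show ?case by (auto simp: lit_right_Suc)
qed (simp add: lit_right_def)

text \<open>The argument is translated by \<open>n\<close> because the way left starts there. It
  stops at \<open>0\<close> without lighting that lamp, which belongs to the way right.\<close>

lemma lamp_left_word:
  "lamp (left_word k S (rev [1..<Suc n])) (q - int n) =
    (if 1 \<le> q \<and> q \<le> int n \<and> nat q \<notin> S then int k else 0)"
proof (induction n)
  case (Suc n)
  have "lamp (left_word k S (rev [1..<Suc (Suc n)])) (q - int (Suc n)) =
      (if q = int (Suc n) \<and> Suc n \<notin> S then int k else 0) +
      lamp (left_word k S (rev [1..<Suc n])) (q - int n)"
    by (simp add: lamp_append left_block_def sgn_of_def)
  also have "\<dots> = (if 1 \<le> q \<and> q \<le> int (Suc n) \<and> nat q \<notin> S then int k else 0)"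
    unfolding Suc by (cases "q = int (Suc n)") (auto simp: nat_add_distrib)
  finally show ?case .
qed simp

lemma length_right_word: "length (right_word k is) = k * length is + (\<Sum>i\<leftarrow>is. 2 ^ i)"
  by (induction "is") (simp_all add: right_block_def)

lemma length_left_word:
  "length (left_word k S (rev [1..<Suc n])) = n + k * card ({1..n} - S)"
proof (induction n)
  case (Suc n)
  have "{1..Suc n} - S = ({1..n} - S) \<union> (if Suc n \<in> S then {} else {Suc n})"
    by (auto simp: le_Suc_eq)
  then have "card ({1..Suc n} - S) = card ({1..n} - S) + (if Suc n \<in> S then 0 else 1)"
    by (simp add: card_insert_if)
  with Suc show ?case by (simp add: left_block_def algebra_simps)
qed simp

text \<open>Visiting lamp \<open>n\<close> and returning to \<open>0\<close> costs
  \<open>2 * n\<close> shifts. Each of the \<open>n + 1\<close> lamps has a count congruent to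
  \<open>k\<close> modulo \<open>m\<close> and so costs at least \<open>k\<close> letters. The word
  \<open>w\<close> attains both bounds because every lamp is lit on exactly one of the two
  ways.\<close>

lemma right_left_minimal:
  fixes m N :: nat
  assumes "m \<ge> 2" "N \<ge> 1"
  defines "k \<equiv> m div 2" and "n \<equiv> 2 ^ N - 1"
  defines "w \<equiv> right_word k [0..<N] @ left_word k (lit_right N) (rev [1..<Suc n])"
  assumes u: "pres_equiv (lamp_relators m) u w"
  shows "length w \<le> length u"
proof -
  let ?S = "lit_right N"
  have k: "0 < k" "k < m" using assms(1) by (auto simp: k_def)
  have 0: "0 \<in> ?S" using assms(2) unfolding lit_right_def by (intro image_eqI[of _ _ 0]) auto
  have curR: "cursor (right_word k [0..<N]) = int n"
    by (simp only: cursor_right_word sum_list_powers n_def)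
  have "cursor w = 0"
    by (simp add: w_def cursor_append curR cursor_left_word del: upt_Suc)
  with pres_equiv_lamp[OF u] have cursor: "cursor u = 0" by simp
  have "lamp w (int q) = int k" if "q \<le> n" for q
  proof -
    have "q \<in> ?S \<or> 1 \<le> q" using 0 by (cases q) auto
    with that show ?thesis
      unfolding w_def lamp_append curR lamp_right_word lamp_left_word by auto
  qed
  then have dvd: "int m dvd lamp u (int q) - int k" if "q \<le> n" for q
    using pres_equiv_lamp[OF u] that by metis
  then have ge: "int k \<le> \<bar>lamp u (int q)\<bar>" if "q \<le> n" for q
    using that abs_ge_half_modulus unfolding k_def by blast
  from ge[of n] k have "lamp u (int n) \<noteq> 0" by auto
  from shift_letters_ge[OF this] have shift: "2 * n \<le> shift_letters u"
    by (simp add: cursor)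
  have "int (k * Suc n) = (\<Sum>q\<in>{..n}. int k)" by (simp add: algebra_simps)
  also have "\<dots> \<le> (\<Sum>q\<in>{..n}. \<bar>lamp u (int q)\<bar>)" by (rule sum_mono) (simp add: ge)
  also have "\<dots> = (\<Sum>q\<in>int ` {..n}. \<bar>lamp u q\<bar>)" by (simp add: sum.reindex)
  also have "\<dots> \<le> int (lamp_letters u)" by (rule lamp_letters_ge) simp
  finally have lamps: "k * Suc n \<le> lamp_letters u" by linarith
  have "length (right_word k [0..<N]) = k * N + n"
    by (simp add: length_right_word sum_list_powers n_def)
  then have "length w = k * N + n + (n + k * card ({1..n} - ?S))"
    unfolding w_def length_append length_left_word by simp
  \<comment> \<open>Since \<open>0\<close> is in \<open>?S\<close>, letting the way left begin its
    count at \<open>1\<close> omits no lamp.\<close>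
  moreover have card: "N + card ({1..n} - ?S) = Suc n"
  proof -
    have S: "?S \<subseteq> {..n}" using lit_right_less by (force simp: n_def)
    have "{1..n} - ?S = {..n} - ?S" using 0 by (auto simp: Suc_le_eq intro: gr0I)
    then show ?thesis
      using card_Diff_subset[of ?S "{..n}"] card_mono[OF _ S] S
      by (simp add: card_lit_right finite_subset)
  qed
  moreover have "k * Suc n = k * N + k * card ({1..n} - ?S)"
    unfolding card[symmetric] by (rule add_mult_distrib2)
  ultimately have "length w = 2 * n + k * Suc n" by linarith
  then show ?thesis using shift lamps length_letters[of u] by linarith
qed

text \<open>The sum lies strictly between \<open>2 ^ j\<close> and \<open>2 ^ Suc j\<close>.\<close>

lemma sum_two_powers_neq: "i < j \<Longrightarrow> 2 ^ i + 2 ^ j \<noteq> (2::nat) ^ r"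
proof
  assume "i < j" and eq: "2 ^ i + 2 ^ j = (2::nat) ^ r"
  then have "(2::nat) ^ j < 2 ^ r"
    by (metis less_add_same_cancel2 zero_less_numeral zero_less_power)
  then have "j < r" by simp
  then have "(2::nat) ^ Suc j \<le> 2 ^ r" by (intro power_increasing) auto
  moreover have "(2::nat) ^ i < 2 ^ j" using \<open>i < j\<close> by simp
  ultimately show False using eq by simp
qed

text \<open>
  If the first block that changes place is \<open>j\<close>, moving to position \<open>i < j\<close>, then the block after
  it starts at \<open>2\<^sup>i - 1 + 2\<^sup>j\<close>, where a lamp is lit on the way back as well.
\<close>

lemma right_left_swap_shortens:
  fixes m N :: nat
  assumes "m \<ge> 2" "i < j"
  defines "k \<equiv> m div 2" and "n \<equiv> 2 ^ N - 1"
  assumes sum: "(\<Sum>i\<leftarrow>[0..<i] @ j # r # rs. 2 ^ i) = n"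
  defines "w \<equiv> right_word k ([0..<i] @ j # r # rs) @ left_word k (lit_right N) (rev [1..<Suc n])"
  shows "\<exists>u. pres_equiv (lamp_relators m) u w \<and> length u < length w"
proof -
  let ?a = "replicate k (Lamp, True)"
  \<comment> \<open>The cursor stands here after the blocks below \<open>i\<close> and block
    \<open>j\<close>, so block \<open>r\<close> lights this lamp.\<close>
  define q :: nat where "q = 2 ^ i - 1 + 2 ^ j"
  have q: "q + 1 = 2 ^ i + 2 ^ j" by (simp add: q_def)
  have n: "n = q + 2 ^ r + (\<Sum>i\<leftarrow>rs. 2 ^ i)"
    unfolding sum[symmetric] q_def
    by (simp only: map_append list.map sum_list.append sum_list.Cons sum_list_powers add.assoc)
  have q_notin: "q \<notin> lit_right N"
  proof
    assume "q \<in> lit_right N"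
    then obtain r where "q = 2 ^ r - 1" by (auto simp: lit_right_def)
    then have "q + 1 = 2 ^ r" by simp
    with sum_two_powers_neq[OF assms(2)] q show False by metis
  qed
  have "1 \<le> q" unfolding q_def by (rule trans_le_add2) simp
  moreover have "q \<le> n" using n by simp
  ultimately have "[1..<Suc n] = [1..<q] @ q # [Suc q..<Suc n]"
    using upt_add_eq_append[of 1 q "Suc n - q"] upt_conv_Cons[of q "Suc n"] by simp
  with q_notin have left: "left_word k (lit_right N) (rev [1..<Suc n]) =
      left_word k (lit_right N) (rev [Suc q..<Suc n]) @ ?a @
      (Shift, False) # left_word k (lit_right N) (rev [1..<q])"
    by (simp add: left_block_def del: upt_Suc)
  \<comment> \<open>Between the two lightings of lamp \<open>q\<close> the cursor goes right to
    \<open>n\<close> and back to \<open>q\<close>, so \<open>v\<close> has cursor \<open>0\<close>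
    and \<open>lit_twice_shortens\<close> applies.\<close>
  define v where "v = replicate (2 ^ r) (Shift, True) @ right_word k rs @
      left_word k (lit_right N) (rev [Suc q..<Suc n])"
  have "w = (right_word k ([0..<i] @ [j])) @ ?a @ v @ ?a @
      (Shift, False) # left_word k (lit_right N) (rev [1..<q])"
    unfolding w_def left v_def by (simp add: right_block_def[of _ r])
  moreover have "cursor v = 0"
    using n by (simp add: v_def cursor_append cursor_right_word cursor_left_word sgn_of_def
        del: upt_Suc)
  ultimately show ?thesis
    using lit_twice_shortens[OF assms(1), of v] unfolding k_def by metis
qed

section \<open>Exchanging blocks in the lamplighter geodesic\<close>

theorem theorem19:
  fixes m :: nat
  assumes "m \<ge> 2"
  shows "\<not> counter (geodesics (lamplighter m) {lamp_a m, lamp_t m})"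
proof
  let ?R = "lamp_relators m"
  let ?c = "map (\<lambda>y. pres_class ?R [y])"
  define L where "L = geodesics (lamplighter m) {lamp_a m, lamp_t m}"
  define k where "k = m div 2"
  assume "counter (geodesics (lamplighter m) {lamp_a m, lamp_t m})"
  then obtain s where s: "\<And>bs z. s \<le> length bs \<Longrightarrow> concat bs @ z \<in> L \<Longrightarrow>
      \<exists>us xs ys vs. bs = us @ xs @ ys @ vs \<and> xs \<noteq> [] \<and> ys \<noteq> [] \<and>
        concat (us @ ys @ xs @ vs) @ z \<in> L"
    using counter_swap unfolding L_def by blast
  have "UNIV = {Lamp, Shift}" using lamp_gen.exhaust by auto
  then have "range (pres_gen ?R) = pres_gen ?R ` {Lamp, Shift}" by (rule arg_cong)
  also have "\<dots> = {lamp_a m, lamp_t m}" by (simp add: lamp_a_def lamp_t_def)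
  finally have gens: "range (pres_gen ?R) = {lamp_a m, lamp_t m}" .
  have L: "?c v \<in> L \<longleftrightarrow> (\<forall>u. pres_equiv ?R u v \<longrightarrow> length v \<le> length u)" for v
    using geodesics_presented_group_iff[of ?R v] by (simp add: L_def lamplighter_def gens)
  \<comment> \<open>This gives at least the \<open>s\<close> blocks required for an exchange, and
    \<open>N \<ge> 1\<close> puts lamp \<open>0\<close> on the way right.\<close>
  define N where "N = Suc s"
  define n :: nat where "n = 2 ^ N - 1"
  define z where "z = left_word k (lit_right N) (rev [1..<Suc n])"
  have c: "concat (map (\<lambda>i. ?c (right_block k i)) is) = ?c (right_word k is)" for "is"
    by (simp add: right_word_def map_concat o_def)
  have "?c (right_word k [0..<N] @ z) \<in> L"
    using right_left_minimal[OF assms, of N] unfolding L z_def k_def n_def by (simp add: N_def)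
  then have "concat (map (\<lambda>i. ?c (right_block k i)) [0..<N]) @ ?c z \<in> L"
    unfolding c by simp
  from s[OF _ this] obtain us xs ys vs where
    split: "map (\<lambda>i. ?c (right_block k i)) [0..<N] = us @ xs @ ys @ vs" "xs \<noteq> []" "ys \<noteq> []"
    and swap: "concat (us @ ys @ xs @ vs) @ ?c z \<in> L"
    by (auto simp: N_def)
  \<comment> \<open>The splitting is pulled back to the list of exponents, whose order shows which
    blocks were moved.\<close>
  from split(1) obtain us' xs' ys' vs' where
    maps: "us = map (\<lambda>i. ?c (right_block k i)) us'" "xs = map (\<lambda>i. ?c (right_block k i)) xs'"
      "ys = map (\<lambda>i. ?c (right_block k i)) ys'" "vs = map (\<lambda>i. ?c (right_block k i)) vs'"
    and upt: "[0..<N] = us' @ xs' @ ys' @ vs'"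
    by (auto simp: map_eq_append_conv append_eq_map_conv)
  have "?c (right_word k (us' @ ys' @ xs' @ vs') @ z) \<in> L"
    using swap unfolding maps map_append[symmetric] c .
  then have min: "length (right_word k (us' @ ys' @ xs' @ vs') @ z) \<le> length u"
    if "pres_equiv ?R u (right_word k (us' @ ys' @ xs' @ vs') @ z)" for u
    using that unfolding L by blast
  obtain x xt j yt where xy: "xs' = x # xt" "ys' = j # yt"
    using split(2,3) by (auto simp: maps neq_Nil_conv)
  \<comment> \<open>The nonempty \<open>xs'\<close> now comes after \<open>ys'\<close>, so some
    block follows block \<open>j\<close>.\<close>
  obtain r rs where r: "yt @ xs' @ vs' = r # rs"
    using xy by (cases "yt @ xs' @ vs'") auto
  have us: "us' = [0..<length us']"
    using arg_cong[OF upt, of "take (length us')"] arg_cong[OF upt, of length]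
    by (simp add: take_upt)
  \<comment> \<open>The first displaced exponent \<open>j\<close> comes later in the increasing list
    than \<open>x\<close>, the exponent it replaces, and \<open>x\<close> is
    \<open>length us'\<close>.\<close>
  have "sorted_wrt (<) (us' @ xs' @ ys' @ vs')" unfolding upt[symmetric] by simp
  then have "x < j" by (simp add: xy sorted_wrt_append)
  moreover have "x = length us'"
  proof -
    have "x = [0..<N] ! length us'" unfolding upt xy by simp
    then show ?thesis using arg_cong[OF upt, of length] by (simp add: xy del: upt_Suc)
  qed
  ultimately have "length us' < j" by simp
  moreover have eq: "us' @ ys' @ xs' @ vs' = [0..<length us'] @ j # r # rs"
    using us r xy(2) by simp
  moreover have "(\<Sum>i\<leftarrow>us' @ ys' @ xs' @ vs'. 2 ^ i) = n"
    using sum_list_powers[of N] unfolding upt n_def by simp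
  ultimately have "\<exists>u. pres_equiv ?R u (right_word k (us' @ ys' @ xs' @ vs') @ z) \<and>
      length u < length (right_word k (us' @ ys' @ xs' @ vs') @ z)"
    using right_left_swap_shortens[OF assms, of "length us'" j r rs N]
    unfolding z_def n_def k_def by simp
  then show False using min by (meson not_less)
qed

end
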